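(* Let $k$ be a positive integer, let $G$ be an $n$-vertex graph, and let $A\in\mathcal{S}(G)$ be a matrix all of whose row sums are equal to a constant $d$. Let $p(x)\in\mathbb{R}_k[x]$ be a polynomial such that $p(A)$ is positive semidefinite and $p(d)>0$. Then $$\alpha_k(G)\leq\frac{n}{p(d)}\max_{u\in V(G)}(p(A))_{uu},$$ $$\vartheta(\overline{G^k})\geq\frac{n\,p(d)}{\mathrm{tr}\,p(A)}.$$
   Context: Graphs are finite, simple, undirected, with nonempty vertex set $V(G)$. $d(i,j)$ denotes the distance between vertices $i$ and $j$ in $G$ (with $d(i,j)=\infty$ if they lie in different components). A $k$-independent set of $G$ is a subset $U\subseteq V(G)$ with $d(i,j)>k$ for any two distinct $i,j\in U$; $\alpha_k(G)$ is the maximum size of a $k$-independent set. The power graph $G^k$ has the same vertices as $G$, two distinct vertices being adjacent iff they are at distance at most $k$ in $G$. $\overline{H}$ denotes the complement of a graph $H$. $\mathbb{R}_k[x]$ is the set of real polynomials of degree at most $k$. $\mathcal{S}(G)$ is the set of real symmetric matrices $A$ indexed by the vertices of $G$ such that $(A)_{ij}=0$ whenever $d(i,j)>1$ (diagonal entries are arbitrary). Lovász theta function: an orthonormal representation of a graph $H$ with vertex set $\{1,\ldots,n\}$ is a set of unit real vectors $\{u_1,\ldots,u_n\}$ (in some Euclidean space) with $u_i^\top u_j=0$ whenever $i,j$ are distinct nonadjacent vertices; its value is $\min_c\max_{1\le i\le n}\frac{1}{(c^\top u_i)^2}$, with $c$ ranging over all unit real vectors; $\vartheta(H)$ is the minimum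 value over all orthonormal representations of $H$. By a theorem of Lovász (1979), which may be taken as known, $\vartheta(H)=\max_B e^\top Be$, where $e$ is the all-ones vector and $B$ ranges over all positive semidefinite real $n\times n$ matrices with $\mathrm{tr}\,B=1$ and $(B)_{ij}=0$ for every $\{i,j\}\in E(H)$. *)

theory Defs
  imports
    "Jordan_Normal_Form.Matrix"
    "Graph_Theory.Graph_Theory"
    "HOL-Analysis.Analysis"
begin

(* Both matrix libraries use these infixes; below they refer to the type real ^ 'n
   and to the class real_inner. *)
no_notation Matrix.vec_index (infixl "$" 100)
no_notation Matrix.scalar_prod (infix "\<bullet>" 70)

section \<open>Graphs\<close>

text \<open>
  A finite simple undirected graph is a \<^locale>\<open>pair_graph\<close>: a finite, loop-free digraph without
  parallel arcs whose arc relation is symmetric.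
\<close>

text \<open>Minimal number of arcs of a walk, and \<open>\<infinity>\<close> if there is no walk.\<close>
definition gdist :: "'a pair_pre_digraph \<Rightarrow> 'a \<Rightarrow> 'a \<Rightarrow> ereal" where
  "gdist G i j = wf_digraph.\<mu> (with_proj G) (\<lambda>_. 1) i j"

definition k_independent :: "nat \<Rightarrow> 'a pair_pre_digraph \<Rightarrow> 'a set \<Rightarrow> bool" where
  "k_independent k G U \<longleftrightarrow>
     U \<subseteq> pverts G \<and> (\<forall>i\<in>U. \<forall>j\<in>U. i \<noteq> j \<longrightarrow> gdist G i j > ereal (real k))"

definition k_independence_number :: "nat \<Rightarrow> 'a pair_pre_digraph \<Rightarrow> nat" where
  "k_independence_number k G = Max (card ` {U. k_independent k G U})"

definition power_graph :: "'a pair_pre_digraph \<Rightarrow> nat \<Rightarrow> 'a pair_pre_digraph" where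
  "power_graph G k = \<lparr> pverts = pverts G,
     parcs = {(i, j). i \<in> pverts G \<and> j \<in> pverts G \<and> i \<noteq> j \<and> gdist G i j \<le> ereal (real k)} \<rparr>"

definition complement_graph :: "'a pair_pre_digraph \<Rightarrow> 'a pair_pre_digraph" where
  "complement_graph H = \<lparr> pverts = pverts H,
     parcs = {(i, j). i \<in> pverts H \<and> j \<in> pverts H \<and> i \<noteq> j \<and> (i, j) \<notin> parcs H} \<rparr>"

section \<open>The Lovasz theta function\<close>

text \<open>
  The dimension \<open>m\<close> of the ambient Euclidean space varies, so its elements are taken from
  \<^term>\<open>carrier_vec m :: real Matrix.vec set\<close> rather than from a type \<open>real ^ 'm\<close>.
\<close>

definition unit_vectors :: "nat \<Rightarrow> real Matrix.vec set" where
  "unit_vectors m = {v \<in> carrier_vec m. scalar_prod v v = 1}"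

definition orthonormal_rep :: "'a pair_pre_digraph \<Rightarrow> nat \<Rightarrow> ('a \<Rightarrow> real Matrix.vec) \<Rightarrow> bool" where
  "orthonormal_rep H m u \<longleftrightarrow>
     (\<forall>i\<in>pverts H. u i \<in> unit_vectors m) \<and>
     (\<forall>i\<in>pverts H. \<forall>j\<in>pverts H.
        i \<noteq> j \<longrightarrow> (i, j) \<notin> parcs H \<longrightarrow> scalar_prod (u i) (u j) = 0)"

text \<open>
  The quotient is taken in the extended reals, where \<open>1 / 0 = \<infinity>\<close>: a vector \<open>c\<close> that is orthogonal
  to some \<open>u i\<close> must not produce a small value, as it would with \<open>1 / 0 = 0\<close> in the reals.
\<close>
definition rep_value :: "'a pair_pre_digraph \<Rightarrow> nat \<Rightarrow> ('a \<Rightarrow> real Matrix.vec) \<Rightarrow> ereal" where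
  "rep_value H m u =
     (INF c\<in>unit_vectors m. Max ((\<lambda>i. 1 / ereal ((scalar_prod c (u i))\<^sup>2)) ` pverts H))"

text \<open>Both minima in the usual definition are attained, so they are written as infima.\<close>
definition lovasz_theta :: "'a pair_pre_digraph \<Rightarrow> ereal" where
  "lovasz_theta H = (INF (m, u)\<in>{(m, u). orthonormal_rep H m u}. rep_value H m u)"

section \<open>Matrices indexed by the vertices\<close>

definition graph_matrices :: "'v::finite pair_pre_digraph \<Rightarrow> (real ^ 'v ^ 'v) set" where
  "graph_matrices G = {A. Finite_Cartesian_Product.transpose A = A \<and>
     (\<forall>i j. gdist G i j > 1 \<longrightarrow> A $ i $ j = 0)}"

text \<open>The type \<open>real ^ 'v ^ 'v\<close> carries the entrywise product as \<open>(*)\<close>, so \<open>A ^ i\<close> would be wrong.\<close>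
primrec matrix_power :: "real ^ 'v ^ 'v \<Rightarrow> nat \<Rightarrow> real ^ 'v::finite ^ 'v" where
  "matrix_power A 0 = Finite_Cartesian_Product.mat 1"
| "matrix_power A (Suc i) = A ** matrix_power A i"

definition poly_matrix :: "real poly \<Rightarrow> real ^ 'v ^ 'v \<Rightarrow> real ^ 'v::finite ^ 'v" where
  "poly_matrix p A = (\<Sum>i\<le>degree p. coeff p i *\<^sub>R matrix_power A i)"

definition pos_semidef :: "real ^ 'v ^ 'v::finite \<Rightarrow> bool" where
  "pos_semidef M \<longleftrightarrow> Finite_Cartesian_Product.transpose M = M \<and> (\<forall>x. x \<bullet> (M *v x) \<ge> 0)"

end

theory Submission
  imports Defs
begin

text \<open>
  Entries of \<open>p(A)\<close> between vertices at distance more than \<open>k\<close> vanish, and the all-ones vector \<open>e\<close>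
  is an eigenvector of \<open>p(A)\<close> for \<open>p(d)\<close>.

  For a \<open>k\<close>-independent set \<open>U\<close>, the principal submatrix of \<open>p(A)\<close> on \<open>U\<close> is diagonal, so the first
  bound is the nonnegativity of the quadratic form of \<open>p(A)\<close> at \<open>1\<^sub>U - (|U| / n) e\<close>.

  For an orthonormal representation \<open>u\<close> of the complement of \<open>G\<^sup>k\<close> and a unit vector \<open>c\<close>, put
  \<open>w\<^sub>i = c - u\<^sub>i / (c\<^sup>T u\<^sub>i)\<close>. Then \<open>w\<^sub>i\<^sup>T w\<^sub>j = u\<^sub>i\<^sup>T u\<^sub>j / ((c\<^sup>T u\<^sub>i) (c\<^sup>T u\<^sub>j)) - 1\<close>, and the
  trace of the product of \<open>p(A)\<close> with this Gram matrix being nonnegative gives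
  \<open>e\<^sup>T p(A) e \<le> \<Sum>\<^sub>i p(A)\<^sub>i\<^sub>i / (c\<^sup>T u\<^sub>i)\<^sup>2\<close>.
\<close>

section \<open>Quadratic forms of positive semidefinite matrices\<close>

lemma pos_semidef_symD: "pos_semidef M \<Longrightarrow> M $ i $ j = M $ j $ i"
  unfolding pos_semidef_def Finite_Cartesian_Product.transpose_def by (metis vec_lambda_beta)

lemma pos_semidef_quadratic_form:
  fixes M :: "real ^ 'v ^ 'v::finite"
  assumes "pos_semidef M"
  shows "(\<Sum>i\<in>UNIV. \<Sum>j\<in>UNIV. M $ i $ j * (f i * f j)) \<ge> 0"
proof -
  have "(\<chi> i. f i) \<bullet> (M *v (\<chi> i. f i)) \<ge> 0"
    using assms by (simp add: pos_semidef_def)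
  then show ?thesis
    by (simp add: inner_vec_def matrix_vector_mult_def sum_distrib_left mult_ac)
qed

text \<open>Exchanging the sums turns the left-hand side into a sum over \<open>a\<close> of
  quadratic forms of \<open>M\<close> at the vectors \<open>f a\<close>. The inner sum over
  \<open>S\<close> is an arbitrary Gram matrix, so this is the trace inequality for two positive
  semidefinite matrices.\<close>

lemma pos_semidef_gram:
  fixes M :: "real ^ 'v ^ 'v::finite"
  assumes "pos_semidef M"
  shows "(\<Sum>i\<in>UNIV. \<Sum>j\<in>UNIV. M $ i $ j * (\<Sum>a\<in>S. f a i * f a j)) \<ge> 0"
proof -
  have "(\<Sum>i\<in>UNIV. \<Sum>j\<in>UNIV. M $ i $ j * (\<Sum>a\<in>S. f a i * f a j))
      = (\<Sum>i\<in>UNIV. \<Sum>a\<in>S. \<Sum>j\<in>UNIV. M $ i $ j * (f a i * f a j))"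
    unfolding sum_distrib_left by (intro sum.cong refl sum.swap)
  also have "\<dots> = (\<Sum>a\<in>S. \<Sum>i\<in>UNIV. \<Sum>j\<in>UNIV. M $ i $ j * (f a i * f a j))"
    by (rule sum.swap)
  also have "\<dots> \<ge> 0"
    by (intro sum_nonneg pos_semidef_quadratic_form assms)
  finally show ?thesis .
qed

lemma pos_semidef_diag_nonneg:
  fixes M :: "real ^ 'v ^ 'v::finite"
  assumes "pos_semidef M"
  shows "M $ i $ i \<ge> 0"
proof -
  have "(\<Sum>a\<in>UNIV. \<Sum>b\<in>UNIV. M $ a $ b * (of_bool (a = i) * of_bool (b = i))) = M $ i $ i"
    by (simp add: of_bool_def if_distrib[of "\<lambda>x. _ * x"] if_distrib[of "\<lambda>x. x * _"] cong: if_cong)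
  then show ?thesis
    using pos_semidef_quadratic_form[OF assms, of "\<lambda>a. of_bool (a = i)"] by simp
qed

section \<open>Distances, walks and the zero pattern of p(A)\<close>

text \<open>Walk lengths are integers: an infimum of at most \<open>k\<close> lies below
  \<open>k + 1\<close>, so some walk has length below \<open>k + 1\<close>, hence at most
  \<open>k\<close>. Without any walk the infimum is infinite and both sides fail.\<close>

lemma gdist_le_iff_awalk:
  assumes "pair_graph G"
  shows "gdist G i j \<le> ereal (real k) \<longleftrightarrow>
    (\<exists>w. pre_digraph.awalk (with_proj G) i w j \<and> length w \<le> k)"
proof -
  interpret pair_graph G by fact
  have cost: "awalk_cost (\<lambda>_. 1) w = real (length w)" for w
    by (induction w) auto
  have dist: "gdist G i j = (INF w\<in>{w. awalk i w j}. ereal (real (length w)))"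
    by (simp add: gdist_def \<mu>_def cost)
  show ?thesis
  proof
    assume "gdist G i j \<le> ereal (real k)"
    also have "\<dots> < ereal (real (Suc k))" by simp
    finally obtain w where "awalk i w j" "length w < Suc k"
      unfolding dist INF_less_iff by (auto simp del: of_nat_Suc)
    then show "\<exists>w. awalk i w j \<and> length w \<le> k" by auto
  next
    assume "\<exists>w. awalk i w j \<and> length w \<le> k"
    then show "gdist G i j \<le> ereal (real k)"
      unfolding dist by (auto intro: INF_lower2)
  qed
qed

lemma gdist_triangle:
  assumes "pair_graph G"
    and "gdist G i l \<le> ereal (real a)" and "gdist G l j \<le> ereal (real b)"
  shows "gdist G i j \<le> ereal (real (a + b))"
proof -
  interpret pair_graph G by fact
  obtain v w where "awalk i v l" "length v \<le> a" "awalk l w j" "length w \<le> b"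
    using assms(2,3) unfolding gdist_le_iff_awalk[OF assms(1)] by blast
  then have "awalk i (v @ w) j \<and> length (v @ w) \<le> a + b"
    by (auto intro: awalk_appendI)
  then show ?thesis
    unfolding gdist_le_iff_awalk[OF assms(1)] by blast
qed

lemma gdist_refl:
  assumes "pair_graph G" and "i \<in> pverts G"
  shows "gdist G i i \<le> ereal (real k)"
proof -
  interpret pair_graph G by fact
  have "awalk i [] i" using assms(2) by (simp add: awalk_Nil_iff)
  then show ?thesis
    unfolding gdist_le_iff_awalk[OF assms(1)] by (intro exI[of _ "[]"]) simp
qed

text \<open>A nonzero entry of a product has a nonzero summand, through some vertex
  \<open>l\<close>: one step of distance at most 1 to \<open>l\<close>, then at most
  \<open>m\<close> more by induction.\<close>

lemma matrix_power_nonzero_gdist: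
  assumes G: "pair_graph G" "pverts G = UNIV" and A: "A \<in> graph_matrices G"
    and "matrix_power A m $ i $ j \<noteq> 0"
  shows "gdist G i j \<le> ereal (real m)"
  using assms(4)
proof (induction m arbitrary: i)
  case 0
  then have "i = j" by (simp add: Finite_Cartesian_Product.mat_def split: if_splits)
  then show ?case using gdist_refl[OF G(1)] G(2) by blast
next
  case (Suc m)
  then have "(\<Sum>l\<in>UNIV. A $ i $ l * matrix_power A m $ l $ j) \<noteq> 0"
    by (simp add: matrix_matrix_mult_def)
  then obtain l where "A $ i $ l * matrix_power A m $ l $ j \<noteq> 0"
    by (meson sum.neutral)
  then have "A $ i $ l \<noteq> 0" and "matrix_power A m $ l $ j \<noteq> 0"
    by auto
  then have "gdist G i l \<le> ereal (real 1)" and "gdist G l j \<le> ereal (real m)"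
    using A Suc.IH by (auto simp: graph_matrices_def not_less[symmetric] one_ereal_def)
  from gdist_triangle[OF G(1) this] show ?case by simp
qed

lemma poly_matrix_nonzero_gdist:
  assumes "pair_graph G" "pverts G = UNIV" "A \<in> graph_matrices G" "degree p \<le> k"
    and "poly_matrix p A $ i $ j \<noteq> 0"
  shows "gdist G i j \<le> ereal (real k)"
proof -
  have "(\<Sum>m\<le>degree p. coeff p m * matrix_power A m $ i $ j) \<noteq> 0"
    using assms(5) by (simp add: poly_matrix_def)
  then obtain m where "m \<le> degree p" and "coeff p m * matrix_power A m $ i $ j \<noteq> 0"
    by (meson atMost_iff sum.neutral)
  then have "gdist G i j \<le> ereal (real m)"
    by (intro matrix_power_nonzero_gdist[OF assms(1-3)]) auto
  also have "\<dots> \<le> ereal (real k)" using \<open>m \<le> degree p\<close> assms(4) by simp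
  finally show ?thesis .
qed

section \<open>Row sums as the eigenvalue of the all-ones vector\<close>

lemma matrix_power_row_sum:
  fixes A :: "real ^ 'v ^ 'v::finite"
  assumes "\<And>i. (\<Sum>j\<in>UNIV. A $ i $ j) = d"
  shows "(\<Sum>j\<in>UNIV. matrix_power A m $ i $ j) = d ^ m"
proof (induction m arbitrary: i)
  case 0
  then show ?case by (simp add: Finite_Cartesian_Product.mat_def)
next
  case (Suc m)
  have "(\<Sum>j\<in>UNIV. matrix_power A (Suc m) $ i $ j)
      = (\<Sum>l\<in>UNIV. \<Sum>j\<in>UNIV. A $ i $ l * matrix_power A m $ l $ j)"
    by (simp add: matrix_matrix_mult_def) (rule sum.swap)
  also have "\<dots> = d * d ^ m"
    by (simp add: sum_distrib_left[symmetric] sum_distrib_right[symmetric] Suc.IH assms)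
  finally show ?case by simp
qed

lemma poly_matrix_row_sum:
  fixes A :: "real ^ 'v ^ 'v::finite"
  assumes "\<And>i. (\<Sum>j\<in>UNIV. A $ i $ j) = d"
  shows "(\<Sum>j\<in>UNIV. poly_matrix p A $ i $ j) = poly p d"
proof -
  have "(\<Sum>j\<in>UNIV. poly_matrix p A $ i $ j)
      = (\<Sum>m\<le>degree p. \<Sum>j\<in>UNIV. coeff p m * matrix_power A m $ i $ j)"
    by (simp add: poly_matrix_def) (rule sum.swap)
  then show ?thesis
    by (simp add: sum_distrib_left[symmetric] matrix_power_row_sum[OF assms] poly_altdef)
qed

section \<open>The bound on k-independent sets\<close>

lemma pos_semidef_diagonal_block_bound:
  fixes M :: "real ^ 'v ^ 'v::finite"
  assumes M: "pos_semidef M" and rows: "\<And>i. (\<Sum>j\<in>UNIV. M $ i $ j) = s"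
    and diag: "\<And>i j. i \<in> U \<Longrightarrow> j \<in> U \<Longrightarrow> i \<noteq> j \<Longrightarrow> M $ i $ j = 0"
  shows "s * (real (card U))\<^sup>2 \<le> real CARD('v) * (\<Sum>u\<in>U. M $ u $ u)"
proof -
  define ind :: "'v \<Rightarrow> real" where "ind = (\<lambda>i. of_bool (i \<in> U))"
  \<comment> \<open>Along \<open>ind - c e\<close> the quadratic form is the trace over
    \<open>U\<close> minus \<open>2 c s |U|\<close> plus \<open>c\<^sup>2 n s\<close>. This
    \<open>c\<close> minimises it, and the terms in \<open>s\<close> collapse to
    \<open>- s |U|\<^sup>2 / n\<close>.\<close>
  define c where "c = real (card U) / real CARD('v)"
  have ind_sum: "(\<Sum>i\<in>UNIV. f i * ind i) = (\<Sum>i\<in>U. f i)" for f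
  proof -
    have "(\<Sum>i\<in>UNIV. f i * ind i) = (\<Sum>i\<in>UNIV. if i \<in> U then f i else 0)"
      by (intro sum.cong) (auto simp: ind_def)
    also have "\<dots> = (\<Sum>i\<in>U. f i)" by (simp add: sum.If_cases)
    finally show ?thesis .
  qed
  have cols: "(\<Sum>i\<in>UNIV. M $ i $ j) = s" for j
    using rows[of j] pos_semidef_symD[OF M, of j] by simp
  have "0 \<le> (\<Sum>i\<in>UNIV. \<Sum>j\<in>UNIV. M $ i $ j * ((ind i - c) * (ind j - c)))"
    by (rule pos_semidef_quadratic_form[OF M])
  also have "\<dots> = (\<Sum>i\<in>UNIV. \<Sum>j\<in>UNIV. M $ i $ j * ind j * ind i)
      - c * (\<Sum>i\<in>UNIV. \<Sum>j\<in>UNIV. M $ i $ j * ind i) - c * (\<Sum>i\<in>UNIV. \<Sum>j\<in>UNIV. M $ i $ j * ind j)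
      + c\<^sup>2 * (\<Sum>i\<in>UNIV. \<Sum>j\<in>UNIV. M $ i $ j)"
    by (simp add: sum_distrib_left sum.distrib[symmetric] sum_subtractf[symmetric]
        algebra_simps power2_eq_square)
  also have "(\<Sum>i\<in>UNIV. \<Sum>j\<in>UNIV. M $ i $ j * ind j * ind i) = (\<Sum>u\<in>U. M $ u $ u)"
  proof -
    have "(\<Sum>i\<in>UNIV. \<Sum>j\<in>UNIV. M $ i $ j * ind j * ind i) = (\<Sum>i\<in>U. \<Sum>j\<in>U. M $ i $ j)"
      by (simp add: sum_distrib_right[symmetric] ind_sum)
    also have "\<dots> = (\<Sum>i\<in>U. \<Sum>j\<in>U. if j = i then M $ i $ i else 0)"
      using diag by (intro sum.cong) auto
    also have "\<dots> = (\<Sum>u\<in>U. M $ u $ u)"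
      by (intro sum.cong) simp_all
    finally show ?thesis .
  qed
  also have "(\<Sum>i\<in>UNIV. \<Sum>j\<in>UNIV. M $ i $ j * ind i) = s * real (card U)"
    by (simp add: sum_distrib_right[symmetric] rows ind_sum)
  also have "(\<Sum>i\<in>UNIV. \<Sum>j\<in>UNIV. M $ i $ j * ind j) = s * real (card U)"
    by (subst sum.swap) (simp add: sum_distrib_right[symmetric] cols ind_sum)
  also have "(\<Sum>i\<in>UNIV. \<Sum>j\<in>UNIV. M $ i $ j) = real CARD('v) * s"
    by (simp add: rows)
  finally have "s * (real (card U))\<^sup>2 / real CARD('v) \<le> (\<Sum>u\<in>U. M $ u $ u)"
    by (simp add: c_def field_simps power2_eq_square)
  then show ?thesis by (simp add: field_simps)
qed

section \<open>The lower bound on the theta function\<close>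

text \<open>
  The easy half of Lovasz's duality theorem, without normalising the trace. If it is zero, the left-hand
  side is \<open>0\<close>.
\<close>
lemma lovasz_theta_ge:
  fixes H :: "'v::finite pair_pre_digraph" and M :: "real ^ 'v ^ 'v"
  assumes H: "pverts H = UNIV" and M: "pos_semidef M"
    and edges: "\<And>i j. (i, j) \<in> parcs H \<Longrightarrow> M $ i $ j = 0"
  shows "ereal ((\<Sum>i\<in>UNIV. \<Sum>j\<in>UNIV. M $ i $ j) / trace M) \<le> lovasz_theta H"
proof -
  have "ereal ((\<Sum>i\<in>UNIV. \<Sum>j\<in>UNIV. M $ i $ j) / trace M)
      \<le> Max ((\<lambda>i. 1 / ereal ((scalar_prod c (u i))\<^sup>2)) ` UNIV)" (is "ereal (?S / _) \<le> Max (range ?g)")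
    if u: "orthonormal_rep H m u" and c: "c \<in> unit_vectors m" for m u c
  proof (cases "\<exists>i. scalar_prod c (u i) = 0")
    case True
    then obtain i where "?g i = \<infinity>" by (auto simp: divide_ereal_def)
    then have "\<infinity> \<le> Max (range ?g)"
      by (metis Max_ge finite finite_imageI rangeI)
    then show ?thesis by simp
  next
    case False
    define x where "x i = 1 / scalar_prod c (u i)" for i
    \<comment> \<open>Coordinate \<open>a\<close> of the vector \<open>w\<^sub>i\<close>; here all
      \<open>c\<^sup>T u\<^sub>i\<close> are nonzero, so \<open>x\<close> involves no division by
      zero.\<close>
    define w where "w a i = vec_index c a - x i * vec_index (u i) a" for a i
    have dims: "dim_vec c = m" "\<And>i. dim_vec (u i) = m"
      and units: "scalar_prod c c = 1" "\<And>i. scalar_prod (u i) (u i) = 1"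
      using u c H by (auto simp: unit_vectors_def orthonormal_rep_def)
    have gram: "(\<Sum>a\<in>{0..<m}. w a i * w a j) = x i * x j * scalar_prod (u i) (u j) - 1" for i j
    proof -
      have "(\<Sum>a\<in>{0..<m}. w a i * w a j) = scalar_prod c c - x i * scalar_prod c (u i)
          - x j * scalar_prod c (u j) + x i * x j * scalar_prod (u i) (u j)"
        by (simp add: w_def scalar_prod_def dims sum_distrib_left sum.distrib[symmetric]
            sum_subtractf[symmetric] algebra_simps)
      then show ?thesis using False by (simp add: x_def units)
    qed
    \<comment> \<open>Off the diagonal, either \<open>M\<close> vanishes on an edge, or on a
      non-edge orthogonality makes the Gram entry -1; both give \<open>- M $ i $ j\<close>. On the
      diagonal the Gram entry is \<open>(x i)\<^sup>2 - 1\<close>.\<close>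
    have entry: "M $ i $ j * (\<Sum>a\<in>{0..<m}. w a i * w a j)
        = (if j = i then M $ i $ i * (x i)\<^sup>2 else 0) - M $ i $ j" for i j
    proof (cases "i = j")
      case True
      then show ?thesis by (simp add: gram units algebra_simps power2_eq_square)
    next
      case False
      then have "M $ i $ j = 0 \<or> scalar_prod (u i) (u j) = 0"
        using u edges unfolding orthonormal_rep_def H by blast
      then show ?thesis using False by (auto simp: gram)
    qed
    have "0 \<le> (\<Sum>i\<in>UNIV. \<Sum>j\<in>UNIV. M $ i $ j * (\<Sum>a\<in>{0..<m}. w a i * w a j))"
      by (rule pos_semidef_gram[OF M])
    also have "\<dots> = (\<Sum>i\<in>UNIV. M $ i $ i * (x i)\<^sup>2) - ?S"
      by (simp add: entry sum_subtractf)
    finally have S: "?S \<le> (\<Sum>i\<in>UNIV. M $ i $ i * (x i)\<^sup>2)" by simp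
    \<comment> \<open>The value of the representation at \<open>c\<close>. Writing it as a square at
      \<open>i0\<close> also shows that it is nonnegative, which settles the case of zero trace
      below, where the quotient is 0.\<close>
    define r where "r = Max (range (\<lambda>i. (x i)\<^sup>2))"
    have "r \<in> range (\<lambda>i. (x i)\<^sup>2)" unfolding r_def by (intro Max_in) auto
    then obtain i0 where i0: "r = (x i0)\<^sup>2" by auto
    have "(\<Sum>i\<in>UNIV. M $ i $ i * (x i)\<^sup>2) \<le> (\<Sum>i\<in>UNIV. M $ i $ i * r)"
      unfolding r_def by (intro sum_mono mult_left_mono pos_semidef_diag_nonneg[OF M] Max_ge) auto
    with S have "?S \<le> r * trace M"
      by (simp add: trace_def sum_distrib_left mult.commute)
    moreover have "trace M \<ge> 0"
      unfolding trace_def by (intro sum_nonneg pos_semidef_diag_nonneg[OF M])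
    ultimately have "?S / trace M \<le> r"
      by (cases "trace M = 0") (auto simp: i0 divide_le_eq)
    then have "ereal (?S / trace M) \<le> ?g i0"
      using False by (simp add: i0 x_def power_divide one_ereal_def)
    also have "\<dots> \<le> Max (range ?g)" by (intro Max_ge) auto
    finally show ?thesis .
  qed
  then show ?thesis
    unfolding lovasz_theta_def rep_value_def H by (auto intro!: INF_greatest)
qed

theorem theorem8:
  fixes G :: "'v::finite pair_pre_digraph"
    and A :: "real ^ 'v ^ 'v"
    and p :: "real poly"
    and d :: real
    and k n :: nat
  assumes "k > 0"
    and "pair_graph G" and "pverts G = UNIV" and "card (pverts G) = n"
    and "A \<in> graph_matrices G"
    and "\<And>i. (\<Sum>j\<in>UNIV. A $ i $ j) = d"
    and "degree p \<le> k"
    and "pos_semidef (poly_matrix p A)"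
    and "poly p d > 0"
  shows "real (k_independence_number k G)
           \<le> real n / poly p d * Max ((\<lambda>u. poly_matrix p A $ u $ u) ` pverts G)
       \<and> lovasz_theta (complement_graph (power_graph G k))
           \<ge> ereal (real n * poly p d / trace (poly_matrix p A))"
proof
  let ?M = "poly_matrix p A"
  note rows = poly_matrix_row_sum[OF assms(6)]
  have n: "n = CARD('v)" using assms(3,4) by simp
  \<comment> \<open>The family is nonempty, so the maximum is attained by some
    \<open>U\<close>.\<close>
  have "k_independent k G {}" by (simp add: k_independent_def)
  then have "k_independence_number k G \<in> card ` {U. k_independent k G U}"
    unfolding k_independence_number_def by (intro Max_in) auto
  then obtain U where U: "k_independent k G U" "k_independence_number k G = card U"
    by auto
  define \<mu> where "\<mu> = Max ((\<lambda>u. ?M $ u $ u) ` pverts G)"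
  have le_mu: "?M $ u $ u \<le> \<mu>" for u
    unfolding \<mu>_def using assms(3) by (intro Max_ge) auto
  have "?M $ i $ j = 0" if "i \<in> U" "j \<in> U" "i \<noteq> j" for i j
    using poly_matrix_nonzero_gdist[OF assms(2,3,5,7), of i j] U(1) that
    by (fastforce simp: k_independent_def not_le[symmetric])
  then have "poly p d * (real (card U))\<^sup>2 \<le> real n * (\<Sum>u\<in>U. ?M $ u $ u)"
    unfolding n by (intro pos_semidef_diagonal_block_bound[OF assms(8) rows])
  also have "\<dots> \<le> real n * (real (card U) * \<mu>)"
    by (intro mult_left_mono sum_bounded_above) (auto simp: le_mu)
  finally have "real (card U) * (poly p d * real (card U)) \<le> real (card U) * (real n * \<mu>)"
    by (simp add: power2_eq_square mult_ac)
  \<comment> \<open>Needed when \<open>U\<close> is empty, where the factor \<open>card U\<close>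
    cannot be cancelled.\<close>
  moreover have "0 \<le> \<mu>"
    using pos_semidef_diag_nonneg[OF assms(8)] le_mu order_trans by blast
  ultimately have "poly p d * real (card U) \<le> real n * \<mu>"
    by (cases "card U = 0") auto
  then show "real (k_independence_number k G) \<le> real n / poly p d * Max ((\<lambda>u. ?M $ u $ u) ` pverts G)"
    using assms(9) by (simp add: U(2) \<mu>_def[symmetric] field_simps)
next
  let ?M = "poly_matrix p A" and ?H = "complement_graph (power_graph G k)"
  \<comment> \<open>Edges of the complement of the power graph join vertices at distance more than
    \<open>k\<close>.\<close>
  have "?M $ i $ j = 0" if "(i, j) \<in> parcs ?H" for i j
    using poly_matrix_nonzero_gdist[OF assms(2,3,5,7), of i j] that
    by (auto simp: complement_graph_def power_graph_def)
  moreover have "pverts ?H = UNIV"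
    using assms(3) by (simp add: complement_graph_def power_graph_def)
  ultimately have "ereal ((\<Sum>i\<in>UNIV. \<Sum>j\<in>UNIV. ?M $ i $ j) / trace ?M) \<le> lovasz_theta ?H"
    by (intro lovasz_theta_ge assms(8))
  then show "ereal (real n * poly p d / trace ?M) \<le> lovasz_theta ?H"
    \<comment> \<open>Each of the \<open>n\<close> rows of \<open>?M\<close> sums to
      \<open>poly p d\<close>, which evaluates the numerator.\<close>
    using assms(3,4) by (simp add: poly_matrix_row_sum[OF assms(6)])
qed

end
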